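(* Let $n\geq 3$ be an even positive integer, and write $n=2^k m$, where $k\geq 1$ and $m$ is an odd positive integer. Then $$\alpha\bigl(\Theta(Q_{4n})\bigr)=4n-2m.$$
   Context: $Q_{4n}=\langle a,b : a^{2n}=1,\ b^2=a^n,\ bab^{-1}=a^{-1}\rangle$ is the dicyclic group of order $4n$. For a finite group $G$, $|g|$ denotes the order of $g\in G$, and the prime-coprime graph $\Theta(G)$ is the simple graph with vertex set $G$ in which two distinct vertices $g,h$ are adjacent if and only if $\gcd(|g|,|h|)$ is either $1$ or a prime. The independence number $\alpha(\Gamma)$ of a graph $\Gamma$ is the maximum cardinality of an independent set of $\Gamma$. *)

theory Defs
  imports
    "HOL-Algebra.Multiplicative_Group"
    "HOL-Computational_Algebra.Primes"
    "Graph_Theory.Pair_Digraph"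
begin

section \<open>Group presentations\<close>

text \<open>
  A word is a list of letters \<open>(x, e)\<close>, where \<open>(x, True)\<close> stands for the generator \<open>x\<close> and
  \<open>(x, False)\<close> for its formal inverse. All elements of the type \<open>'g\<close> serve as generators.
\<close>

type_synonym 'g word = "('g \<times> bool) list"

text \<open>
  The congruence on words generated by free cancellation and a set of relations,
  a pair \<open>(u, v)\<close> standing for the relation \<open>u = v\<close>.
\<close>

inductive pres_eq :: "('g word \<times> 'g word) set \<Rightarrow> 'g word \<Rightarrow> 'g word \<Rightarrow> bool"
  for R :: "('g word \<times> 'g word) set"
where
  pres_refl: "pres_eq R u u"
| pres_sym: "pres_eq R u v \<Longrightarrow> pres_eq R v u"
| pres_trans: "pres_eq R u v \<Longrightarrow> pres_eq R v w \<Longrightarrow> pres_eq R u w"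
| pres_append: "pres_eq R u u' \<Longrightarrow> pres_eq R v v' \<Longrightarrow> pres_eq R (u @ v) (u' @ v')"
| pres_cancel: "pres_eq R [(x, e), (x, \<not> e)] []"
| pres_rel: "(u, v) \<in> R \<Longrightarrow> pres_eq R u v"

definition pres_class :: "('g word \<times> 'g word) set \<Rightarrow> 'g word \<Rightarrow> 'g word set" where
  "pres_class R u = {v. pres_eq R u v}"

definition presented_group :: "('g word \<times> 'g word) set \<Rightarrow> 'g word set monoid" where
  "presented_group R =
    \<lparr>carrier = range (pres_class R),
     monoid.mult = (\<lambda>X Y. {w. \<exists>u\<in>X. \<exists>v\<in>Y. pres_eq R (u @ v) w}),
     one = pres_class R []\<rparr>"

lemma pres_class_eq_iff: "pres_class R u = pres_class R v \<longleftrightarrow> pres_eq R u v"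
  unfolding pres_class_def using pres_refl pres_sym pres_trans by blast

lemma presented_group_simps:
  "carrier (presented_group R) = range (pres_class R)"
  "pres_class R u \<otimes>\<^bsub>presented_group R\<^esub> pres_class R v = pres_class R (u @ v)"
  "\<one>\<^bsub>presented_group R\<^esub> = pres_class R []"
  unfolding presented_group_def pres_class_def
  by (auto intro: pres_refl pres_trans pres_append)

definition word_inv :: "'g word \<Rightarrow> 'g word" where
  "word_inv w = rev (map (\<lambda>(x, e). (x, \<not> e)) w)"

lemma pres_eq_word_inv: "pres_eq R (word_inv w @ w) []"
proof (induction w)
  case Nil
  then show ?case by (simp add: word_inv_def pres_refl)
next
  case (Cons l w)
  obtain x e where l: "l = (x, e)" by (cases l)
  have "pres_eq R ([(x, \<not> e), (x, e)] @ w) ([] @ w)"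
    using pres_cancel[of R x "\<not> e"] by (intro pres_append pres_refl) simp
  then have "pres_eq R (word_inv w @ ([(x, \<not> e), (x, e)] @ w)) (word_inv w @ w)"
    by (intro pres_append pres_refl) simp
  with Cons show ?case
    by (auto simp: l word_inv_def intro: pres_trans)
qed

lemma group_presented_group: "group (presented_group R)"
proof (rule groupI)
  fix X assume "X \<in> carrier (presented_group R)"
  then obtain u where "X = pres_class R u" by (auto simp: presented_group_simps)
  then have "pres_class R (word_inv u) \<otimes>\<^bsub>presented_group R\<^esub> X = \<one>\<^bsub>presented_group R\<^esub>"
    by (simp add: presented_group_simps pres_class_eq_iff pres_eq_word_inv)
  then show "\<exists>Y\<in>carrier (presented_group R). Y \<otimes>\<^bsub>presented_group R\<^esub> X = \<one>\<^bsub>presented_group R\<^esub>"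
    by (auto simp: presented_group_simps(1))
qed (auto simp: presented_group_simps)

definition word_eval :: "('a, 'm) monoid_scheme \<Rightarrow> ('g \<Rightarrow> 'a) \<Rightarrow> 'g word \<Rightarrow> 'a" where
  "word_eval H f w =
     foldr (\<lambda>(x, e) y. (if e then f x else inv\<^bsub>H\<^esub> f x) \<otimes>\<^bsub>H\<^esub> y) w \<one>\<^bsub>H\<^esub>"

text \<open>The universal property of the presented group.\<close>

lemma presented_group_universal:
  assumes "group H" and f: "\<And>x. f x \<in> carrier H"
    and rel: "\<And>u v. (u, v) \<in> R \<Longrightarrow> word_eval H f u = word_eval H f v"
  shows "\<exists>h \<in> hom (presented_group R) H. \<forall>u. h (pres_class R u) = word_eval H f u"
proof -
  interpret H: group H by fact
  have closed: "word_eval H f u \<in> carrier H" for u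
    by (induction u) (auto simp: word_eval_def f)
  have app: "word_eval H f (u @ v) = word_eval H f u \<otimes>\<^bsub>H\<^esub> word_eval H f v" for u v
  proof (induction u)
    case Nil
    then show ?case using closed by (simp add: word_eval_def)
  next
    case (Cons l u)
    obtain x e where "l = (x, e)" by (cases l)
    with Cons show ?case using closed[of u] closed[of v]
      by (simp add: word_eval_def f H.m_assoc)
  qed
  have eq: "word_eval H f u = word_eval H f v" if "pres_eq R u v" for u v
    using that
  proof induction
    case (pres_cancel x e)
    then show ?case by (simp add: word_eval_def f)
  qed (auto simp: app rel)
  define h where "h X = word_eval H f (SOME u. u \<in> X)" for X
  have h: "h (pres_class R u) = word_eval H f u" for u
  proof -
    have "(SOME v. v \<in> pres_class R u) \<in> pres_class R u"
      by (rule someI[of _ u]) (simp add: pres_class_def pres_refl)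
    then show ?thesis unfolding h_def pres_class_def by (simp add: eq)
  qed
  have "h \<in> hom (presented_group R) H"
    by (rule homI) (auto simp: presented_group_simps h closed app)
  with h show ?thesis by blast
qed

section \<open>The dicyclic group\<close>

datatype dic_gen = GenA | GenB

definition dicyclic_relations :: "nat \<Rightarrow> (dic_gen word \<times> dic_gen word) set" where
  "dicyclic_relations n =
    {(replicate (2 * n) (GenA, True), []),
     (replicate 2 (GenB, True), replicate n (GenA, True)),
     ([(GenB, True), (GenA, True), (GenB, False)], [(GenA, False)])}"

definition dicyclic_group :: "nat \<Rightarrow> dic_gen word set monoid" where
  "dicyclic_group n = presented_group (dicyclic_relations n)"

section \<open>The prime-coprime graph and the independence number\<close>

text \<open>A simple graph is represented by a loop-free symmetric digraph, cf. \<open>pair_graph\<close>.\<close>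

definition prime_coprime_graph :: "('a, 'm) monoid_scheme \<Rightarrow> 'a pair_pre_digraph" where
  "prime_coprime_graph G =
    \<lparr>pverts = carrier G,
     parcs = {(g, h). g \<in> carrier G \<and> h \<in> carrier G \<and> g \<noteq> h \<and>
       (gcd (group.ord G g) (group.ord G h) = 1 \<or> prime (gcd (group.ord G g) (group.ord G h)))}\<rparr>"

lemma pair_graph_prime_coprime_graph:
  assumes "finite (carrier G)"
  shows "pair_graph (prime_coprime_graph G)"
proof
  show "finite (parcs (prime_coprime_graph G))"
    by (rule finite_subset[of _ "carrier G \<times> carrier G"])
       (use assms in \<open>auto simp: prime_coprime_graph_def\<close>)
  show "symmetric (prime_coprime_graph G)"
    by (auto simp: symmetric_def sym_def prime_coprime_graph_def gcd.commute)
qed (use assms in \<open>auto simp: prime_coprime_graph_def\<close>)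

definition independent_set :: "'a pair_pre_digraph \<Rightarrow> 'a set \<Rightarrow> bool" where
  "independent_set \<Gamma> S \<longleftrightarrow> S \<subseteq> pverts \<Gamma> \<and> (\<forall>u\<in>S. \<forall>v\<in>S. (u, v) \<notin> parcs \<Gamma>)"

text \<open>Only meaningful for graphs with finitely many vertices, as it uses \<open>Max\<close> and \<open>card\<close>.\<close>

definition independence_number :: "'a pair_pre_digraph \<Rightarrow> nat" where
  "independence_number \<Gamma> = Max {card S | S. independent_set \<Gamma> S}"

end

(* Every element of Q_4n outside the cyclic group generated by a has order 4.  The elements of
   order divisible by 4 form an independent set, and its complement consists of the 2m powers
   of a^(2^k).  An independent set meeting this complement contains no element of order 4, hence
   lies in the cyclic group of order 2n, and 2n is at most 4n - 2m because 2m divides n.  That a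
   has order exactly 2n in the presented group is seen in a concrete model on pairs (i, e),
   standing for a^i b^e. *)

theory Submission
  imports Defs
begin

section \<open>Presented groups\<close>

lemma word_eval_replicate:
  assumes "group H" and "f x \<in> carrier H"
  shows "word_eval H f (replicate j (x, True)) = f x [^]\<^bsub>H\<^esub> j"
proof -
  interpret group H by fact
  show ?thesis
  proof (induction j)
    case 0
    then show ?case by (simp add: word_eval_def)
  next
    case (Suc j)
    then show ?case
      using assms nat_pow_Suc2[of "f x" j] by (simp add: word_eval_def del: nat_pow_Suc)
  qed
qed

lemma pres_class_in_carrier [simp]: "pres_class R u \<in> carrier (presented_group R)"
  by (simp add: presented_group_simps)

lemma pres_class_replicate:
  "pres_class R (replicate j l) = pres_class R [l] [^]\<^bsub>presented_group R\<^esub> j"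
proof -
  interpret group "presented_group R" by (rule group_presented_group)
  show ?thesis
  proof (induction j)
    case 0
    then show ?case by (simp add: presented_group_simps)
  next
    case (Suc j)
    then show ?case
      using nat_pow_Suc2[of "pres_class R [l]" j]
        presented_group_simps(2)[of R "[l]" "replicate j l"] by (simp del: nat_pow_Suc)
  qed
qed

lemma pres_class_inverse_letter:
  "pres_class R [(x, False)] = inv\<^bsub>presented_group R\<^esub> pres_class R [(x, True)]"
proof -
  interpret group "presented_group R" by (rule group_presented_group)
  have "pres_eq R [(x, False), (x, True)] []"
    using pres_cancel[of R x False] by simp
  then have "pres_class R [(x, False)] \<otimes>\<^bsub>presented_group R\<^esub> pres_class R [(x, True)] =
      \<one>\<^bsub>presented_group R\<^esub>"
    by (simp add: presented_group_simps pres_class_eq_iff)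
  then show ?thesis by (simp add: inv_equality)
qed

text \<open>A word is the product of its letters, and a negative letter is the inverse of a
  generator, so induction on the word suffices. This supplies the locale assumption
  \<open>generated\<close> below.\<close>

lemma generate_presented_group:
  "generate (presented_group R) (range (\<lambda>x. pres_class R [(x, True)])) =
    carrier (presented_group R)"
    (is "generate ?G ?X = _")
proof
  interpret group ?G by (rule group_presented_group)
  show "generate ?G ?X \<subseteq> carrier ?G" by (rule generate_incl) auto
  have "pres_class R u \<in> generate ?G ?X" for u
  proof (induction u)
    case Nil
    then show ?case using generate.one[of ?G ?X] by (simp add: presented_group_simps)
  next
    case (Cons l u)
    obtain x e where l: "l = (x, e)" by (cases l)
    have "pres_class R [l] \<in> generate ?G ?X"
      by (cases e) (auto simp: l pres_class_inverse_letter intro: generate.incl generate.inv)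
    then have "pres_class R [l] \<otimes>\<^bsub>?G\<^esub> pres_class R u \<in> generate ?G ?X"
      using Cons by (rule generate.eng)
    then show ?case by (simp add: presented_group_simps)
  qed
  then show "carrier ?G \<subseteq> generate ?G ?X" by (auto simp: presented_group_simps(1))
qed

section \<open>Orders in a dicyclic group\<close>

text \<open>Orders and cardinalities are derived from these assumptions, free of words. The
  relations alone bound the group from above; \<open>ord_a\<close> and \<open>b_notin\<close> say
  that nothing collapses further.\<close>

locale dicyclic = group +
  fixes a b and n :: nat
  assumes n_pos: "n > 0"
    and a_closed [simp]: "a \<in> carrier G" and b_closed [simp]: "b \<in> carrier G"
    and ord_a: "ord a = 2 * n"
    and b_squared: "b \<otimes> b = a [^] n"
    and conj_b: "b \<otimes> a \<otimes> inv b = inv a"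
    and b_notin: "b \<notin> range (\<lambda>i::nat. a [^] i)"
    and generated: "generate G {a, b} = carrier G"
begin

section \<open>Commutation rules and normal forms\<close>

lemma pow_a_eq_one_iff: "a [^] (i::nat) = \<one> \<longleftrightarrow> 2 * n dvd i"
  using pow_eq_id[of a i] ord_a by simp

text \<open>The exponent is congruent to \<open>- i\<close> modulo \<open>2 * n\<close>; this form
  keeps all exponents natural numbers.\<close>

lemma inv_pow_a: "inv (a [^] (i::nat)) = a [^] ((2 * n - 1) * i)"
proof (rule inv_equality)
  have "(2 * n - 1) * i + i = 2 * n * i" using n_pos by (cases n) auto
  then show "a [^] ((2 * n - 1) * i) \<otimes> a [^] i = \<one>"
    by (simp add: nat_pow_mult pow_a_eq_one_iff)
qed auto

lemma b_pow_a: "b \<otimes> a [^] (i::nat) = inv (a [^] i) \<otimes> b"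
proof (induction i)
  case 0
  then show ?case by simp
next
  case (Suc i)
  have ba: "b \<otimes> a = inv a \<otimes> b"
    using conj_b inv_solve_right'[of "inv a" "b \<otimes> a" b] by simp
  have "b \<otimes> a [^] Suc i = inv (a [^] i) \<otimes> (b \<otimes> a)"
    using Suc by (simp add: m_assoc[symmetric])
  also have "\<dots> = (inv (a [^] i) \<otimes> inv a) \<otimes> b"
    by (simp add: ba m_assoc)
  also have "inv (a [^] i) \<otimes> inv a = inv (a [^] Suc i)"
    using nat_pow_Suc2[of a i] by (simp add: inv_mult_group del: nat_pow_Suc)
  finally show ?case .
qed

text \<open>Moving the inner \<open>b\<close> past \<open>a [^] i\<close> inverts that power, so the
  powers of \<open>a\<close> cancel and \<open>b \<otimes> b\<close> remains.\<close>

lemma square_outside: "(a [^] (i::nat) \<otimes> b) [^] (2::nat) = a [^] n"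
proof -
  have "(a [^] i \<otimes> b) [^] (2::nat) = a [^] i \<otimes> (b \<otimes> a [^] i) \<otimes> b"
    by (simp add: numeral_2_eq_2 m_assoc)
  also have "\<dots> = (a [^] i \<otimes> inv (a [^] i)) \<otimes> (b \<otimes> b)"
    by (simp only: b_pow_a m_assoc nat_pow_closed inv_closed m_closed a_closed b_closed)
  finally show ?thesis by (simp add: b_squared)
qed

lemma ord_outside: "ord (a [^] (i::nat) \<otimes> b) = 4"
proof -
  let ?x = "a [^] i \<otimes> b"
  have "?x [^] (4::nat) = (?x [^] (2::nat)) [^] (2::nat)" by (simp add: nat_pow_pow)
  also have "\<dots> = a [^] (n * 2)" by (simp only: square_outside nat_pow_pow a_closed)
  finally have "?x [^] (4::nat) = \<one>" by (simp add: pow_a_eq_one_iff)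
  then have "ord ?x dvd 2 ^ 2" using pow_eq_id[of ?x 4] by simp
  then obtain j where j: "j \<le> 2" "ord ?x = 2 ^ j"
    using divides_primepow_nat[of 2 "ord ?x" 2] by auto
  \<comment> \<open>The square is \<open>a [^] n\<close>, which is not \<open>\<one>\<close> because
    \<open>0 < n < 2 * n\<close>. Among the divisors of 4 only 4 is left.\<close>
  have "\<not> ord ?x dvd 2"
    using pow_eq_id[of ?x 2] n_pos square_outside[of i]
    by (auto simp: pow_a_eq_one_iff dest: dvd_imp_le)
  with j show ?thesis by (cases j; cases "j - 1") auto
qed

text \<open>The set \<open>C\<close> of normal forms contains the generators and their inverses and
  is closed under products, so it is the whole group.\<close>

lemma carrier_cases:
  assumes "g \<in> carrier G"
  obtains i :: nat where "g = a [^] i" | i :: nat where "g = a [^] i \<otimes> b"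
proof -
  define C where "C = range (\<lambda>i::nat. a [^] i) \<union> range (\<lambda>i::nat. a [^] i \<otimes> b)"
  have aC: "a \<in> C" using nat_pow_eone[of a] unfolding C_def
    by (metis UnI1 a_closed rangeI)
  have bC: "b \<in> C" using l_one[of b] nat_pow_0[of a] unfolding C_def
    by (metis UnI2 b_closed rangeI)
  have powC: "a [^] i \<in> C" "a [^] i \<otimes> b \<in> C" for i :: nat by (auto simp: C_def)
  have C_cl: "x \<in> carrier G" if "x \<in> C" for x using that by (auto simp: C_def)
  have mult: "x \<otimes> y \<in> C" if x: "x \<in> C" and y: "y \<in> C" for x y
  proof -
    have bC': "b \<otimes> y \<in> C"
      using y unfolding C_def
    proof safe
      fix i :: nat
      have "b \<otimes> a [^] i = a [^] ((2 * n - 1) * i) \<otimes> b" by (simp add: b_pow_a inv_pow_a)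
      \<comment> \<open>\<open>safe\<close> replaces the union by its first half under the negation
        of the second; the equation just found contradicts that negation.\<close>
      then show "b \<otimes> a [^] i \<in> range (\<lambda>i::nat. a [^] i)" if "b \<otimes> a [^] i \<notin> range (\<lambda>i::nat. a [^] i \<otimes> b)"
        using that by auto
      have "b \<otimes> (a [^] i \<otimes> b) = (b \<otimes> a [^] i) \<otimes> b" by (simp add: m_assoc)
      also have "\<dots> = a [^] ((2 * n - 1) * i) \<otimes> (b \<otimes> b)"
        by (simp add: b_pow_a inv_pow_a m_assoc)
      also have "\<dots> = a [^] ((2 * n - 1) * i + n)" by (simp add: b_squared nat_pow_mult)
      finally show "b \<otimes> (a [^] i \<otimes> b) \<in> range (\<lambda>i::nat. a [^] i)" by auto
    qed
    have aC': "a [^] (i::nat) \<otimes> z \<in> C" if "z \<in> C" for i z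
      using that by (auto simp: C_def nat_pow_mult m_assoc[symmetric])
    consider i :: nat where "x = a [^] i" | i :: nat where "x = a [^] i \<otimes> b"
      using x by (auto simp: C_def)
    then show ?thesis
      using aC'[OF y] aC'[OF bC'] C_cl[OF y] by cases (simp_all add: m_assoc)
  qed
  have inv_a: "inv a \<in> C" using inv_pow_a[of 1] powC by simp
  \<comment> \<open>The fourth power of \<open>b\<close> is \<open>a [^] (2 * n) = \<one>\<close>,
    so closure under products already covers \<open>inv b\<close>.\<close>
  have b3: "inv b = b \<otimes> b \<otimes> b"
  proof (rule inv_equality)
    have "b \<otimes> b \<otimes> b \<otimes> b = (b \<otimes> b) \<otimes> (b \<otimes> b)" by (simp add: m_assoc)
    also have "\<dots> = \<one>" by (simp add: b_squared nat_pow_mult pow_a_eq_one_iff flip: mult_2)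
    finally show "b \<otimes> b \<otimes> b \<otimes> b = \<one>" .
  qed auto
  have inv_b: "inv b \<in> C" by (simp add: b3 bC mult)
  have "g \<in> generate G {a, b}" using assms generated by simp
  then have "g \<in> C"
  proof induction
    case one
    then show ?case using powC(1)[of 0] by simp
  qed (auto intro: aC bC inv_a inv_b mult)
  then show thesis using that by (auto simp: C_def)
qed

section \<open>Enumeration of the elements\<close>

definition cyclic_part :: "'a set" where
  "cyclic_part = (\<lambda>i::nat. a [^] i) ` {..<2 * n}"

definition outer_part :: "'a set" where
  "outer_part = (\<lambda>i::nat. a [^] i \<otimes> b) ` {..<2 * n}"

lemma pow_a_mod: "a [^] (i mod (2 * n)) = a [^] i"
proof -
  have "a [^] i = a [^] (2 * n * (i div (2 * n)) + i mod (2 * n))" by simp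
  also have "\<dots> = a [^] (2 * n * (i div (2 * n))) \<otimes> a [^] (i mod (2 * n))"
    by (simp only: nat_pow_mult a_closed)
  also have "a [^] (2 * n * (i div (2 * n))) = \<one>" by (simp add: pow_a_eq_one_iff)
  finally show ?thesis by simp
qed

lemma inj_on_pow_a: "inj_on (\<lambda>i::nat. a [^] i) {..<2 * n}"
proof (rule inj_onI)
  fix i j :: nat
  assume "i \<in> {..<2 * n}" "j \<in> {..<2 * n}" "a [^] i = a [^] j"
  then show "i = j"
    using ord_inj[of a] ord_a n_pos by (auto simp: inj_on_def)
qed

lemma carrier_eq: "carrier G = cyclic_part \<union> outer_part"
proof
  show "carrier G \<subseteq> cyclic_part \<union> outer_part"
  proof
    fix g assume "g \<in> carrier G"
    then show "g \<in> cyclic_part \<union> outer_part"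
    proof (cases rule: carrier_cases)
      case (1 i)
      then have "g = a [^] (i mod (2 * n))" by (simp add: pow_a_mod)
      then show ?thesis using n_pos by (auto simp: cyclic_part_def)
    next
      case (2 i)
      then have "g = a [^] (i mod (2 * n)) \<otimes> b" by (simp add: pow_a_mod)
      then show ?thesis using n_pos by (auto simp: outer_part_def)
    qed
  qed
qed (auto simp: cyclic_part_def outer_part_def)

lemma card_cyclic_part: "card cyclic_part = 2 * n"
  by (simp add: cyclic_part_def card_image inj_on_pow_a)

lemma card_carrier: "card (carrier G) = 4 * n"
proof -
  have "inj_on (\<lambda>i::nat. a [^] i \<otimes> b) {..<2 * n}"
    using inj_on_pow_a by (auto simp: inj_on_def)
  then have outer: "card outer_part = 2 * n"
    by (simp add: outer_part_def card_image)
  \<comment> \<open>An equality would make \<open>b\<close> a power of \<open>a\<close>, so the two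
    cosets are disjoint.\<close>
  have disj: "a [^] i \<noteq> a [^] j \<otimes> b" for i j :: nat
  proof
    assume "a [^] i = a [^] j \<otimes> b"
    then have "b = inv (a [^] j) \<otimes> a [^] i" by (simp add: inv_solve_left)
    also have "\<dots> = a [^] ((2 * n - 1) * j + i)" by (simp add: inv_pow_a nat_pow_mult)
    finally show False using b_notin by auto
  qed
  have "cyclic_part \<inter> outer_part = {}"
    using disj unfolding cyclic_part_def outer_part_def by blast
  then have "card (carrier G) = card cyclic_part + card outer_part"
    unfolding carrier_eq by (intro card_Un_disjoint) (auto simp: cyclic_part_def outer_part_def)
  then show ?thesis by (simp add: outer card_cyclic_part)
qed

section \<open>Elements of order divisible by 4\<close>

text \<open>The 2-part of \<open>ord a\<close> is \<open>2 ^ (k + 1)\<close>, and passing to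
  \<open>a [^] i\<close> removes from it the factors 2 that \<open>i\<close> supplies; at least two
  remain exactly if \<open>i\<close> supplies fewer than \<open>k\<close>.\<close>

lemma four_dvd_ord_pow_a_iff:
  assumes n: "n = 2 ^ k * m" and "odd m"
  shows "4 dvd ord (a [^] (i::nat)) \<longleftrightarrow> \<not> 2 ^ k dvd i"
proof
  let ?o = "ord (a [^] i)"
  \<comment> \<open>The order enters only through the exponents that it divides.\<close>
  have ann: "?o dvd j \<longleftrightarrow> 2 ^ (k + 1) * m dvd i * j" for j
    using pow_eq_id[of "a [^] i" j] by (simp add: nat_pow_pow pow_a_eq_one_iff n mult.assoc)
  show "\<not> 2 ^ k dvd i" if "4 dvd ?o"
  proof
    assume "2 ^ k dvd i"
    then have "?o dvd 2 * m" unfolding ann by (auto elim!: dvdE)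
    with that have "2 * 2 dvd 2 * m" by (metis dvd_trans mult_2 numeral_Bit0)
    with \<open>odd m\<close> show False by simp
  qed
  show "4 dvd ?o" if "\<not> 2 ^ k dvd i"
  proof (rule ccontr)
    assume no: "\<not> 4 dvd ?o"
    obtain q where q: "odd q" "?o = q \<or> ?o = 2 * q"
    proof (cases "even ?o")
      case True
      then obtain q where "?o = 2 * q" by blast
      with no show thesis using that[of q] by auto
    qed (use that in auto)
    \<comment> \<open>This is \<open>ann\<close> at \<open>j = ?o\<close>. The order contributes at
      most one factor 2, so the other \<open>k\<close> must come from \<open>i\<close>.\<close>
    have "2 ^ (k + 1) dvd i * ?o" by (rule dvd_mult_left[OF iffD1[OF ann dvd_refl]])
    also have "i * ?o dvd 2 * (i * q)" using q(2) by (elim disjE) simp_all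
    finally have "2 ^ k dvd i * q" by simp
    moreover have "coprime (2 ^ k) q" using q by simp
    ultimately show False using \<open>\<not> 2 ^ k dvd i\<close> by (simp add: coprime_dvd_mult_left_iff)
  qed
qed

text \<open>Counted through the complement, the powers \<open>a [^] i\<close> with
  \<open>2 ^ k\<close> dividing \<open>i\<close>. As \<open>2 * n = 2 ^ k * (2 * m)\<close>, there
  are \<open>2 * m\<close> such exponents below \<open>2 * n\<close>.\<close>

lemma card_four_dvd_ord:
  assumes "n = 2 ^ k * m" and "odd m"
  shows "card {g \<in> carrier G. 4 dvd ord g} = 4 * n - 2 * m"
proof -
  let ?T = "{g \<in> carrier G. 4 dvd ord g}"
  let ?U = "(\<lambda>i::nat. a [^] i) ` ((*) (2 ^ k) ` {..<2 * m})"
  have outer: "4 dvd ord g" if "g \<in> outer_part" for g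
    using that by (auto simp: outer_part_def ord_outside)
  have "carrier G - ?T = {g \<in> cyclic_part. \<not> 4 dvd ord g}"
    using outer by (auto simp: carrier_eq)
  also have "\<dots> = (\<lambda>i::nat. a [^] i) ` {i \<in> {..<2 * n}. 2 ^ k dvd i}"
    by (auto simp: cyclic_part_def four_dvd_ord_pow_a_iff[OF assms])
  also have "{i \<in> {..<2 * n}. 2 ^ k dvd i} = (*) (2 ^ k) ` {..<2 * m}"
    using assms(1) by (auto simp: dvd_def)
  finally have diff: "carrier G - ?T = ?U" .
  have sub: "(*) (2 ^ k) ` {..<2 * m} \<subseteq> {..<2 * n}"
    using assms(1) by auto
  have "card ?U = card ((*) ((2::nat) ^ k) ` {..<2 * m})"
    by (intro card_image inj_on_subset[OF inj_on_pow_a sub])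
  also have "\<dots> = 2 * m" by (subst card_image) (auto simp: inj_on_def)
  finally have U: "card ?U = 2 * m" .
  have fin: "finite (carrier G)" using card_carrier n_pos card_gt_0_iff by fastforce
  have "card (carrier G - ?T) = card (carrier G) - card ?T"
    by (rule card_Diff_subset) (use fin in auto)
  moreover have "card ?T \<le> card (carrier G)" by (rule card_mono) (use fin in auto)
  ultimately show ?thesis using U diff card_carrier by simp
qed

section \<open>Independent sets\<close>

lemma independence_number_dicyclic:
  assumes "n = 2 ^ k * m" and "k \<ge> 1" and "odd m"
  shows "independence_number (prime_coprime_graph G) = 4 * n - 2 * m"
  unfolding independence_number_def
proof (rule Max_eqI)
  let ?\<Gamma> = "prime_coprime_graph G" and ?T = "{g \<in> carrier G. 4 dvd ord g}"
  have fin: "finite (carrier G)" using card_carrier n_pos card_gt_0_iff by fastforce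
  have "{card S |S. independent_set ?\<Gamma> S} \<subseteq> card ` Pow (carrier G)"
    by (auto simp: independent_set_def prime_coprime_graph_def)
  then show "finite {card S |S. independent_set ?\<Gamma> S}"
    using fin finite_subset by blast
  have np: "\<not> prime q \<and> q \<noteq> 1" if "4 dvd q" for q :: nat
  proof -
    have "\<not> prime q"
    proof
      assume "prime q"
      moreover have "2 dvd q" using that dvd_trans[of 2 4 q] by simp
      ultimately have "q = 2" using primes_dvd_imp_eq[of 2 q] by simp
      with that show False by simp
    qed
    with that show ?thesis by auto
  qed
  \<comment> \<open>For two members of \<open>?T\<close>, 4 divides the gcd of their orders, which
    is then neither 1 nor prime.\<close>
  have "independent_set ?\<Gamma> ?T"
    unfolding independent_set_def prime_coprime_graph_def using np
    by (auto simp flip: One_nat_def)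
  then show "4 * n - 2 * m \<in> {card S |S. independent_set ?\<Gamma> S}"
    using card_four_dvd_ord[OF assms(1,3)] by force
  fix c assume "c \<in> {card S |S. independent_set ?\<Gamma> S}"
  then obtain S where c: "c = card S" and S: "independent_set ?\<Gamma> S" by auto
  then have S_sub: "S \<subseteq> carrier G" by (auto simp: independent_set_def prime_coprime_graph_def)
  show "c \<le> 4 * n - 2 * m"
  proof (cases "S \<subseteq> ?T")
    case True
    then show ?thesis
      using card_mono[of ?T S] fin card_four_dvd_ord[OF assms(1,3)] c by simp
  next
    case False
    then obtain g where g: "g \<in> S" "\<not> 4 dvd ord g" using S_sub by blast
    \<comment> \<open>Elements of \<open>outer_part\<close> have order 4. The gcd of 4 with
      \<open>ord g\<close> divides 4 but is not 4, so it is 1 or 2 and \<open>g\<close> is adjacent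
      to all of them.\<close>
    have "x \<notin> outer_part" if "x \<in> S" for x
    proof
      assume "x \<in> outer_part"
      then have x: "ord x = 4" by (auto simp: outer_part_def ord_outside)
      have "gcd (ord g) 4 dvd 2 ^ 2" by simp
      then obtain j where j: "j \<le> 2" "gcd (ord g) 4 = 2 ^ j"
        using divides_primepow_nat[of 2 "gcd (ord g) 4" 2] by auto
      have "j \<noteq> 2" using g(2) j(2) gcd_dvd1[of "ord g" 4] by auto
      with j have "gcd (ord g) (ord x) = 1 \<or> prime (gcd (ord g) (ord x))"
        unfolding x by (cases "j = 0"; cases "j = 1") auto
      moreover have "g \<noteq> x" using g x by auto
      ultimately have "(g, x) \<in> parcs ?\<Gamma>"
        using g that S_sub by (auto simp: prime_coprime_graph_def)
      then show False using S g that by (auto simp: independent_set_def)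
    qed
    then have "S \<subseteq> cyclic_part" using S_sub by (auto simp: carrier_eq)
    then have "card S \<le> 2 * n"
      using card_mono[of cyclic_part S] card_cyclic_part by (simp add: cyclic_part_def)
    \<comment> \<open>This makes \<open>4 * n - 2 * m\<close> at least \<open>3 * n\<close>, above
      the bound \<open>2 * n\<close> for this case.\<close>
    moreover have "2 * m \<le> n"
    proof -
      have "(2::nat) ^ 1 \<le> 2 ^ k" using assms(2) by (intro power_increasing) auto
      then show ?thesis using assms(1) by simp
    qed
    ultimately show ?thesis using c by simp
  qed
qed

end

section \<open>A model of the dicyclic group\<close>

text \<open>The pair \<open>(i, e)\<close> stands for \<open>a\<^sup>i\<close> if \<open>e\<close> is false and for \<open>a\<^sup>i b\<close> if \<open>e\<close> is true.\<close>

definition dicyclic_model :: "nat \<Rightarrow> (int \<times> bool) monoid" where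
  "dicyclic_model n =
    \<lparr>carrier = {0..<2 * int n} \<times> UNIV,
     monoid.mult = (\<lambda>(i, e) (j, f).
       ((i + (if e then - j else j) + (if e \<and> f then int n else 0)) mod (2 * int n), e \<noteq> f)),
     one = (0, False)\<rparr>"

text \<open>In a nested product of the model, an inner first component reduced modulo
  \<open>2 * n\<close> may occur in a difference; these rules remove that reduction.\<close>

lemma mod_diff_add_eq:
  fixes s t u c :: int
  shows "(s mod c - t + u) mod c = (s - t + u) mod c"
    and "(t - s mod c + u) mod c = (t - s + u) mod c"
  by (metis mod_add_left_eq mod_diff_left_eq) (metis mod_add_left_eq mod_diff_right_eq)

lemma group_dicyclic_model:
  assumes "n > 0"
  shows "group (dicyclic_model n)"
proof (rule groupI)
  fix x y z
  assume "x \<in> carrier (dicyclic_model n)" "y \<in> carrier (dicyclic_model n)"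
    "z \<in> carrier (dicyclic_model n)"
  obtain i e j f l g where "x = (i, e)" "y = (j, f)" "z = (l, g)"
    by (cases x; cases y; cases z) blast
  \<comment> \<open>This is associativity when \<open>e\<close>, \<open>f\<close> and
    \<open>g\<close> are all true: the sides differ by \<open>2 * n\<close>. In the other cases they
    agree before reduction.\<close>
  moreover have "(i - (j - l + int n)) mod (2 * int n) = (i - j + int n + l) mod (2 * int n)"
    unfolding mod_eq_dvd_iff by (rule dvdI[of _ _ "- 1"]) simp
  ultimately show "x \<otimes>\<^bsub>dicyclic_model n\<^esub> y \<otimes>\<^bsub>dicyclic_model n\<^esub> z =
      x \<otimes>\<^bsub>dicyclic_model n\<^esub> (y \<otimes>\<^bsub>dicyclic_model n\<^esub> z)"
    by (cases e; cases f; cases g)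
      (simp_all add: dicyclic_model_def mod_simps mod_diff_add_eq, simp_all add: algebra_simps)
next
  fix x
  assume "x \<in> carrier (dicyclic_model n)"
  then obtain i e where x: "x = (i, e)" "0 \<le> i" "i < 2 * int n"
    by (auto simp: dicyclic_model_def)
  show "\<exists>y\<in>carrier (dicyclic_model n). y \<otimes>\<^bsub>dicyclic_model n\<^esub> x = \<one>\<^bsub>dicyclic_model n\<^esub>"
  proof (cases e)
    case True
    then show ?thesis
      using x assms
      \<comment> \<open>The square of \<open>a^i b\<close> is \<open>a^n\<close>, so its inverse is
        \<open>a^(i+n) b\<close>.\<close>
      by (intro bexI[of _ "((i + int n) mod (2 * int n), True)"])
        (auto simp: dicyclic_model_def mod_diff_add_eq)
  next
    case False
    then show ?thesis
      using x assms
      by (intro bexI[of _ "(- i mod (2 * int n), False)"])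
        (auto simp: dicyclic_model_def mod_simps)
  qed
qed (use assms in \<open>auto simp: dicyclic_model_def\<close>)

section \<open>From the presentation to the locale\<close>

text \<open>Equations in the presented group come from its relations. The lower bound on the order
  of \<open>a\<close> and the fact that \<open>b\<close> is no power of \<open>a\<close> come from a
  homomorphism \<open>h\<close> into the model.\<close>

lemma dicyclic_dicyclic_group:
  assumes "n > 0"
  shows "dicyclic (dicyclic_group n)
    (pres_class (dicyclic_relations n) [(GenA, True)])
    (pres_class (dicyclic_relations n) [(GenB, True)]) n"
proof -
  let ?R = "dicyclic_relations n" and ?G = "dicyclic_group n" and ?H = "dicyclic_model n"
  let ?a = "pres_class ?R [(GenA, True)]" and ?b = "pres_class ?R [(GenB, True)]"
  define f :: "dic_gen \<Rightarrow> int \<times> bool"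
    where "f x = (case x of GenA \<Rightarrow> (1, False) | GenB \<Rightarrow> (0, True))" for x
  interpret G: group ?G unfolding dicyclic_group_def by (rule group_presented_group)
  interpret H: group ?H using assms by (rule group_dicyclic_model)
  have cl: "pres_class ?R u \<in> carrier ?G" for u by (simp add: dicyclic_group_def)
  have f: "f x \<in> carrier ?H" for x
    using assms by (cases x) (auto simp: f_def dicyclic_model_def)
  have rel: "pres_class ?R u = pres_class ?R v" if "(u, v) \<in> ?R" for u v
    using that by (simp add: pres_class_eq_iff pres_rel)
  have pow_model: "(1, False) [^]\<^bsub>?H\<^esub> (i::nat) = (int i mod (2 * int n), False)" for i
    by (induction i) (auto simp: dicyclic_model_def mod_simps ac_simps)
  have inv_a: "inv\<^bsub>?H\<^esub> (1, False) = (- 1 mod (2 * int n), False)"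
    by (rule H.inv_equality) (use assms in \<open>auto simp: dicyclic_model_def mod_simps\<close>)
  have inv_b: "inv\<^bsub>?H\<^esub> (0, True) = (int n, True)"
    by (rule H.inv_equality) (use assms in \<open>auto simp: dicyclic_model_def mod_simps\<close>)
  \<comment> \<open>The model satisfies each of the three relations, so the universal property
    yields \<open>h\<close>.\<close>
  have "word_eval ?H f u = word_eval ?H f v" if uv: "(u, v) \<in> ?R" for u v
  proof -
    consider "u = replicate (2 * n) (GenA, True)" "v = []"
      | "u = replicate 2 (GenB, True)" "v = replicate n (GenA, True)"
      | "u = [(GenB, True), (GenA, True), (GenB, False)]" "v = [(GenA, False)]"
      using uv unfolding dicyclic_relations_def insert_iff empty_iff prod.inject by blast
    then show ?thesis
    proof cases
      case 1
      then show ?thesis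
        using f[of GenA] word_eval_replicate[OF H.group_axioms, of f GenA "2 * n"]
        by (simp add: f_def pow_model) (simp add: word_eval_def dicyclic_model_def)
    next
      case 2
      have "(0, True) \<otimes>\<^bsub>?H\<^esub> (0, True) = (int n, False)"
        using assms by (simp add: dicyclic_model_def)
      then have "word_eval ?H f u = (int n, False)"
        using 2 f[of GenB] word_eval_replicate[OF H.group_axioms, of f GenB 2]
        by (simp add: f_def numeral_2_eq_2)
      moreover have "word_eval ?H f v = (int n, False)"
        using 2 f[of GenA] word_eval_replicate[OF H.group_axioms, of f GenA n] assms
        by (simp add: f_def pow_model)
      ultimately show ?thesis by simp
    next
      case 3
      then show ?thesis using assms
        by (simp add: word_eval_def f_def inv_a inv_b)
          (simp add: dicyclic_model_def mod_simps)
    qed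
  qed
  then obtain h where h: "h \<in> hom ?G ?H" "h (pres_class ?R u) = word_eval ?H f u" for u
    using presented_group_universal[of ?H f ?R] H.group_axioms f
    unfolding dicyclic_group_def by blast
  have pow: "?a [^]\<^bsub>?G\<^esub> i = pres_class ?R (replicate i (GenA, True))" for i :: nat
    by (simp add: dicyclic_group_def pres_class_replicate)
  have h_pow: "h (?a [^]\<^bsub>?G\<^esub> i) = (int i mod (2 * int n), False)" for i :: nat
    using f[of GenA] word_eval_replicate[OF H.group_axioms, of f GenA i]
    by (simp add: pow h(2)) (simp add: f_def pow_model)
  have h_b: "h ?b = (0, True)"
    using f[of GenB] word_eval_replicate[OF H.group_axioms, of f GenB 1]
    by (simp add: h(2) f_def)
  have one: "\<one>\<^bsub>?G\<^esub> = pres_class ?R []" by (simp add: dicyclic_group_def presented_group_simps)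
  have mult: "pres_class ?R u \<otimes>\<^bsub>?G\<^esub> pres_class ?R v = pres_class ?R (u @ v)" for u v
    by (simp add: dicyclic_group_def presented_group_simps)
  have inv: "inv\<^bsub>?G\<^esub> pres_class ?R [(x, True)] = pres_class ?R [(x, False)]" for x
    by (simp add: dicyclic_group_def pres_class_inverse_letter)
  show ?thesis
  proof (unfold_locales, goal_cases)
    case 1
    show ?case by fact
  next
    case 4
    show ?case
    proof (rule dvd_antisym)
      have "?a [^]\<^bsub>?G\<^esub> (2 * n) = \<one>\<^bsub>?G\<^esub>"
        unfolding pow one by (rule rel) (simp add: dicyclic_relations_def)
      then show "G.ord ?a dvd 2 * n" using G.pow_eq_id[OF cl] by blast
      have "?a [^]\<^bsub>?G\<^esub> G.ord ?a = ?a [^]\<^bsub>?G\<^esub> (0::nat)"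
        using G.pow_ord_eq_1[OF cl] by simp
      then have "h (?a [^]\<^bsub>?G\<^esub> G.ord ?a) = h (?a [^]\<^bsub>?G\<^esub> (0::nat))" by simp
      \<comment> \<open>The model records exponents of \<open>a\<close> modulo \<open>2 * n\<close>,
        so an exponent that kills \<open>a\<close> is a multiple of \<open>2 * n\<close>.\<close>
      then have "int (G.ord ?a) mod (2 * int n) = 0" unfolding h_pow by simp
      then have "int (2 * n) dvd int (G.ord ?a)" by auto
      then show "2 * n dvd G.ord ?a" by (simp only: of_nat_dvd_iff)
    qed
  next
    case 5
    have "pres_class ?R (replicate 2 (GenB, True)) = pres_class ?R (replicate n (GenA, True))"
      by (rule rel) (simp add: dicyclic_relations_def)
    then show ?case by (simp add: pow mult numeral_2_eq_2)
  next
    case 6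
    show ?case unfolding inv mult by (rule rel) (simp add: dicyclic_relations_def)
  next
    case 7
    show ?case
    proof
      assume "?b \<in> range (\<lambda>i::nat. ?a [^]\<^bsub>?G\<^esub> i)"
      then obtain i :: nat where "?b = ?a [^]\<^bsub>?G\<^esub> i" by blast
      then have "h ?b = h (?a [^]\<^bsub>?G\<^esub> i)" by simp
      \<comment> \<open>The second component separates them: it is true for \<open>b\<close> and
        false for every power of \<open>a\<close>.\<close>
      then show False unfolding h_b h_pow by simp
    qed
  next
    case 8
    have gens: "UNIV = {GenA, GenB}" using dic_gen.exhaust by auto
    show ?case
      using generate_presented_group[of ?R] by (simp add: dicyclic_group_def gens)
  qed (rule cl)+
qed

theorem proposition3p18:
  fixes n k m :: nat
  assumes "n \<ge> 3" and "even n"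
    and "n = 2 ^ k * m" and "k \<ge> 1" and "odd m"
  shows "independence_number (prime_coprime_graph (dicyclic_group n)) = 4 * n - 2 * m"
proof -
  interpret dicyclic "dicyclic_group n"
    "pres_class (dicyclic_relations n) [(GenA, True)]"
    "pres_class (dicyclic_relations n) [(GenB, True)]" n
    using assms(1) by (intro dicyclic_dicyclic_group) simp
  show ?thesis using assms(3-5) by (rule independence_number_dicyclic)
qed

end
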